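(* Let $h: J\to[0,\infty)$ and $f:I\to(0,\infty)$. (i) If $h$ is superadditive and $f$ is $\mathrm{H_tA_h}$-convex, then for all $x,y,z\in I$ $$f\left(\frac{2xz}{x+z}\right)+f\left(\frac{2yz}{y+z}\right)+f\left(\frac{2xy}{x+y}\right)\le h(3/2)\,f\left(\frac{3xyz}{xy+yz+xz}\right)+h(1/2)\left[f(x)+f(y)+f(z)\right].$$ (ii) If $h$ is subadditive and $f$ is $\mathrm{H_tA_h}$-concave, then the reverse inequality ($\ge$) holds for all $x,y,z\in I$.
   Context: $I\subseteq(0,\infty)$ is an interval. $J$ is a real interval containing $(0,1)$ and the point $3/2$. The function $h:J\to[0,\infty)$ is such that $h(t)$ and $h(1-t)$ are never both zero. $h$ is superadditive (resp. subadditive) if $h(s+t)\ge h(s)+h(t)$ (resp. $\le$) whenever $s,t,s+t\in J$. A function $f:I\to(0,\infty)$ is $\mathrm{H_tA_h}$-convex if $$f\left(\frac{\alpha\beta}{t\alpha+(1-t)\beta}\right)\le h(1-t)f(\alpha)+h(t)f(\beta)$$ for all $\alpha,\beta\in I$ and all $t\in[0,1]$ with $t,1-t\in J$; it is $\mathrm{H_tA_h}$-concave if the reverse inequality ($\ge$) holds for all such $\alpha,\beta,t$. *)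

theory Defs
  imports "HOL-Analysis.Analysis"
begin

definition superadditive_on :: "real set \<Rightarrow> (real \<Rightarrow> real) \<Rightarrow> bool" where
  "superadditive_on J h \<longleftrightarrow>
     (\<forall>s\<in>J. \<forall>t\<in>J. s + t \<in> J \<longrightarrow> h (s + t) \<ge> h s + h t)"

definition subadditive_on :: "real set \<Rightarrow> (real \<Rightarrow> real) \<Rightarrow> bool" where
  "subadditive_on J h \<longleftrightarrow>
     (\<forall>s\<in>J. \<forall>t\<in>J. s + t \<in> J \<longrightarrow> h (s + t) \<le> h s + h t)"

text \<open>
  The weight \<open>h\<close> is only meaningful on \<open>J\<close>, which contains \<open>{0<..<1}\<close> but possibly neither
  \<open>0\<close> nor anything negative; hence the endpoints \<open>t = 0\<close> and \<open>t = 1\<close> are tested only if both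
  \<open>t\<close> and \<open>1 - t\<close> lie in \<open>J\<close>.
\<close>

definition HtAh_convex_on ::
    "real set \<Rightarrow> (real \<Rightarrow> real) \<Rightarrow> real set \<Rightarrow> (real \<Rightarrow> real) \<Rightarrow> bool" where
  "HtAh_convex_on J h I f \<longleftrightarrow>
     (\<forall>\<alpha>\<in>I. \<forall>\<beta>\<in>I. \<forall>t\<in>{0..1}. t \<in> J \<longrightarrow> 1 - t \<in> J \<longrightarrow>
        f (\<alpha> * \<beta> / (t * \<alpha> + (1 - t) * \<beta>)) \<le> h (1 - t) * f \<alpha> + h t * f \<beta>)"

definition HtAh_concave_on ::
    "real set \<Rightarrow> (real \<Rightarrow> real) \<Rightarrow> real set \<Rightarrow> (real \<Rightarrow> real) \<Rightarrow> bool" where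
  "HtAh_concave_on J h I f \<longleftrightarrow>
     (\<forall>\<alpha>\<in>I. \<forall>\<beta>\<in>I. \<forall>t\<in>{0..1}. t \<in> J \<longrightarrow> 1 - t \<in> J \<longrightarrow>
        f (\<alpha> * \<beta> / (t * \<alpha> + (1 - t) * \<beta>)) \<ge> h (1 - t) * f \<alpha> + h t * f \<beta>)"

end

theory Submission
  imports Defs
begin

text \<open>
  Under the substitution \<open>u = 1/x\<close> the harmonic combination \<open>\<alpha>\<beta> / (t\<alpha> + (1-t)\<beta>)\<close> becomes the ordinary
  one \<open>(1-t) u + t v\<close>, and the claim becomes a Popoviciu inequality for \<open>g u = f (1/u)\<close>: the values of
  \<open>g\<close> at the three midpoints of \<open>u, v, w\<close> are compared with those at \<open>u, v, w\<close> and at their mean \<open>m\<close>.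

  Two of the deviations \<open>u - m\<close>, \<open>v - m\<close>, \<open>w - m\<close> have the same sign, say the first two. Since
  \<open>w - m = - (u - m) - (v - m)\<close>, the midpoints \<open>(u + w)/2\<close> and \<open>(v + w)/2\<close> then lie between \<open>w\<close> and \<open>m\<close>:
  they equal \<open>(1-s) w + s m\<close> and \<open>(1-t) w + t m\<close> with \<open>s + t = 3/2\<close>. Convexity at these two points
  produces the coefficients \<open>h s + h t\<close> of \<open>g m\<close> and \<open>h (1-s) + h (1-t)\<close> of \<open>g w\<close>, which superadditivity
  bounds by \<open>h (3/2)\<close> and \<open>h (1/2)\<close>; the remaining midpoint \<open>(u + v)/2\<close> is handled by convexity with
  \<open>t = 1/2\<close>. This is lemma \<open>popoviciu_same_side\<close>.

  The case \<open>{s, t} = {1, 1/2}\<close> is separate, because \<open>h\<close> need not be defined at \<open>1 - s = 0\<close>. There the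
  inequality \<open>g m \<le> h 1 * g m\<close> takes the place of convexity; it follows from convexity at the midpoint of
  \<open>m\<close> and itself together with superadditivity for \<open>1/2 + 1/2 = 1\<close>.

  The concave case is the convex one for \<open>-f\<close>. To make this literally true, superadditivity of \<open>h\<close> enters
  only through \<open>(h s + h t) * g u \<le> h (s+t) * g u\<close>, which covers both a superadditive \<open>h\<close> with \<open>g \<ge> 0\<close>
  and a subadditive \<open>h\<close> with \<open>g \<le> 0\<close>.
\<close>

text \<open>
  The weights \<open>s\<close> and \<open>t\<close> range over \<open>[1/2, 1]\<close>. For \<open>s, t < 1\<close> all weights that occur are positive, so
  convexity applies at both points; a weight equal to 1 forces the other to be \<open>1/2\<close>.
\<close>

lemma sum_two_points_le_of_weights:
  fixes h g :: "real \<Rightarrow> real"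
  assumes conv: "\<And>u v t. u \<in> K \<Longrightarrow> v \<in> K \<Longrightarrow> 0 < t \<Longrightarrow> t < 1 \<Longrightarrow>
                   g ((1 - t) * u + t * v) \<le> h (1 - t) * g u + h t * g v"
    and weight: "\<And>s t u. 0 < s \<Longrightarrow> 0 < t \<Longrightarrow> s + t \<le> 3/2 \<Longrightarrow> u \<in> K \<Longrightarrow>
                   (h s + h t) * g u \<le> h (s + t) * g u"
    and "a \<in> K" "b \<in> K" "s \<le> 1" "t \<le> 1" and st: "s + t = 3/2"
  shows "g ((1 - s) * a + s * b) + g ((1 - t) * a + t * b) \<le> h (3/2) * g b + h (1/2) * g a"
proof -
  have endpoint: "g b + g ((1/2) * a + (1/2) * b) \<le> h (3/2) * g b + h (1/2) * g a"
  proof -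
    have "g b \<le> h (1/2) * g b + h (1/2) * g b"
      using conv[of b b "1/2"] \<open>b \<in> K\<close> by simp
    also have "\<dots> \<le> h 1 * g b"
      using weight[of "1/2" "1/2" b] \<open>b \<in> K\<close> by (simp add: algebra_simps)
    finally have "g b \<le> h 1 * g b" .
    moreover have "h 1 * g b + h (1/2) * g b \<le> h (3/2) * g b"
      using weight[of 1 "1/2" b] \<open>b \<in> K\<close> by (simp add: algebra_simps)
    moreover have "g ((1/2) * a + (1/2) * b) \<le> h (1/2) * g a + h (1/2) * g b"
      using conv[of a b "1/2"] \<open>a \<in> K\<close> \<open>b \<in> K\<close> by simp
    ultimately show ?thesis by linarith
  qed
  consider "s = 1" "t = 1/2" | "t = 1" "s = 1/2" | "s < 1" "t < 1"
    using assms(5,6) st by fastforce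
  then show ?thesis
  proof cases
    case 1
    show ?thesis unfolding 1 using endpoint by simp
  next
    case 2
    show ?thesis unfolding 2 using endpoint by simp
  next
    case 3
    have "0 < s" "0 < t" using 3 st by linarith+
    have "(h s + h t) * g b \<le> h (3/2) * g b"
      using weight[of s t b] \<open>0 < s\<close> \<open>0 < t\<close> st \<open>b \<in> K\<close> by simp
    moreover have "(h (1 - s) + h (1 - t)) * g a \<le> h (1/2) * g a"
    proof -
      have "(1 - s) + (1 - t) = 1/2" using st by linarith
      with weight[of "1 - s" "1 - t" a] 3 \<open>a \<in> K\<close> show ?thesis
        by simp
    qed
    moreover have "g ((1 - s) * a + s * b) \<le> h (1 - s) * g a + h s * g b"
      using conv[of a b s] 3 \<open>0 < s\<close> \<open>a \<in> K\<close> \<open>b \<in> K\<close> by simp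
    moreover have "g ((1 - t) * a + t * b) \<le> h (1 - t) * g a + h t * g b"
      using conv[of a b t] 3 \<open>0 < t\<close> \<open>a \<in> K\<close> \<open>b \<in> K\<close> by simp
    ultimately show ?thesis by (simp add: algebra_simps)
  qed
qed

text \<open>
  With \<open>p = u - m\<close> and \<open>q = v - m\<close> one has \<open>w - m = - (p + q)\<close>, hence \<open>(u + w)/2 - m = - q/2\<close> and
  \<open>(v + w)/2 - m = - p/2\<close>. These are the multiples of \<open>w - m\<close> by \<open>q / (2 (p + q))\<close> and \<open>p / (2 (p + q))\<close>,
  which are nonnegative with sum \<open>1/2\<close> because \<open>p\<close> and \<open>q\<close> have the same sign. If \<open>p + q = 0\<close>, the
  same-sign condition forces \<open>u = v = w = m\<close>, and any two weights with sum \<open>3/2\<close> will do.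
\<close>

lemma popoviciu_same_side:
  fixes h g :: "real \<Rightarrow> real" and u v w :: real
  defines "m \<equiv> (u + v + w) / 3"
  assumes K: "convex K"
    and conv: "\<And>u v t. u \<in> K \<Longrightarrow> v \<in> K \<Longrightarrow> 0 < t \<Longrightarrow> t < 1 \<Longrightarrow>
                   g ((1 - t) * u + t * v) \<le> h (1 - t) * g u + h t * g v"
    and weight: "\<And>s t u. 0 < s \<Longrightarrow> 0 < t \<Longrightarrow> s + t \<le> 3/2 \<Longrightarrow> u \<in> K \<Longrightarrow>
                   (h s + h t) * g u \<le> h (s + t) * g u"
    and uvw: "u \<in> K" "v \<in> K" "w \<in> K"
    and same_side: "0 \<le> (u - m) * (v - m)"
  shows "g ((u + w) / 2) + g ((v + w) / 2) + g ((u + v) / 2)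
           \<le> h (3/2) * g m + h (1/2) * (g u + g v + g w)"
proof -
  have "m \<in> K"
  proof -
    have "(2/3) *\<^sub>R ((1/2) *\<^sub>R u + (1/2) *\<^sub>R v) + (1/3) *\<^sub>R w \<in> K"
      using uvw by (intro convexD[OF K]) auto
    then show ?thesis by (simp add: m_def add_divide_distrib)
  qed
  define p q where "p = u - m" and "q = v - m"
  have w: "w = m - (p + q)" and u: "u = m + p" and v: "v = m + q"
    by (simp_all add: p_def q_def m_def field_simps)
  obtain s t where st: "s \<le> 1" "t \<le> 1" "s + t = 3/2"
    and s: "(u + w) / 2 = (1 - s) * w + s * m" and t: "(v + w) / 2 = (1 - t) * w + t * m"
  proof (cases "p + q = 0")
    case True
    then have "q = - p" by linarith
    then have "p = 0" "q = 0"
      using same_side unfolding p_def[symmetric] q_def[symmetric]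
      by (auto simp: zero_le_mult_iff mult_le_0_iff)
    then show ?thesis using that[of 1 "1/2"] by (simp add: u v w)
  next
    case False
    define c d where "c = p / (p + q)" and "d = q / (p + q)"
    have nonneg: "0 \<le> c" "0 \<le> d"
      using same_side unfolding p_def[symmetric] q_def[symmetric] c_def d_def
      by (auto simp: zero_le_mult_iff zero_le_divide_iff)
    have sum1: "c + d = 1"
      using False by (simp add: c_def d_def add_divide_distrib[symmetric])
    have cancel: "c * (p + q) = p" "d * (p + q) = q"
      using False by (simp_all add: c_def d_def)
    show ?thesis
    proof (rule that[of "1 - d / 2" "1 - c / 2"])
      have "(u + w) / 2 = m - d * (p + q) / 2"
        unfolding cancel u w by (simp add: field_simps)
      also have "\<dots> = (1 - (1 - d / 2)) * w + (1 - d / 2) * m"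
        unfolding w by (simp add: field_simps)
      finally show "(u + w) / 2 = (1 - (1 - d / 2)) * w + (1 - d / 2) * m" .
      have "(v + w) / 2 = m - c * (p + q) / 2"
        unfolding cancel v w by (simp add: field_simps)
      also have "\<dots> = (1 - (1 - c / 2)) * w + (1 - c / 2) * m"
        unfolding w by (simp add: field_simps)
      finally show "(v + w) / 2 = (1 - (1 - c / 2)) * w + (1 - c / 2) * m" .
    qed (use nonneg sum1 in linarith)+
  qed
  have "g ((u + w) / 2) + g ((v + w) / 2) \<le> h (3/2) * g m + h (1/2) * g w"
    unfolding s t using conv weight \<open>w \<in> K\<close> \<open>m \<in> K\<close> st
    by (rule sum_two_points_le_of_weights)
  moreover have "g ((u + v) / 2) \<le> h (1/2) * g u + h (1/2) * g v"
    using conv[of u v "1/2"] uvw by (simp add: add_divide_distrib)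
  ultimately show ?thesis by (simp add: algebra_simps)
qed

lemma popoviciu_weighted:
  fixes h g :: "real \<Rightarrow> real"
  assumes K: "convex K"
    and conv: "\<And>u v t. u \<in> K \<Longrightarrow> v \<in> K \<Longrightarrow> 0 < t \<Longrightarrow> t < 1 \<Longrightarrow>
                   g ((1 - t) * u + t * v) \<le> h (1 - t) * g u + h t * g v"
    and weight: "\<And>s t u. 0 < s \<Longrightarrow> 0 < t \<Longrightarrow> s + t \<le> 3/2 \<Longrightarrow> u \<in> K \<Longrightarrow>
                   (h s + h t) * g u \<le> h (s + t) * g u"
    and uvw: "u \<in> K" "v \<in> K" "w \<in> K"
  shows "g ((u + w) / 2) + g ((v + w) / 2) + g ((u + v) / 2)
           \<le> h (3/2) * g ((u + v + w) / 3) + h (1/2) * (g u + g v + g w)"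
proof -
  define m where "m = (u + v + w) / 3"
  note same_side = popoviciu_same_side[where K = K and g = g and h = h, OF K conv weight]
  \<comment> \<open>Three signs take at most two values, and the inequality is symmetric in \<open>u, v, w\<close>.\<close>
  consider "0 \<le> (u - m) * (v - m)" | "0 \<le> (u - m) * (w - m)" | "0 \<le> (v - m) * (w - m)"
    by (metis linorder_le_cases zero_le_mult_iff diff_ge_0_iff_ge diff_le_0_iff_le)
  then show ?thesis
  proof cases
    case 1
    then show ?thesis using same_side[of u v w] uvw by (simp add: m_def)
  next
    case 2
    then show ?thesis using same_side[of u w v] uvw by (simp add: m_def ac_simps)
  next
    case 3
    then show ?thesis using same_side[of v w u] uvw by (simp add: m_def ac_simps)
  qed
qed

text \<open>
  The transfer to harmonic means: on \<open>K = inverse ` I\<close>, again an interval, the function \<open>u \<mapsto> F (1/u)\<close>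
  satisfies the hypotheses of the arithmetic inequality. The sign of \<open>F\<close> is left open so that \<open>F\<close> can be
  \<open>f\<close> or \<open>-f\<close>.
\<close>

lemma popoviciu_weighted_harmonic:
  fixes h F :: "real \<Rightarrow> real"
  assumes I: "is_interval I" "I \<subseteq> {0<..}"
    and conv: "\<And>a b t. a \<in> I \<Longrightarrow> b \<in> I \<Longrightarrow> 0 < t \<Longrightarrow> t < 1 \<Longrightarrow>
                   F (a * b / (t * a + (1 - t) * b)) \<le> h (1 - t) * F a + h t * F b"
    and weight: "\<And>s t a. 0 < s \<Longrightarrow> 0 < t \<Longrightarrow> s + t \<le> 3/2 \<Longrightarrow> a \<in> I \<Longrightarrow>
                   (h s + h t) * F a \<le> h (s + t) * F a"
    and xyz: "x \<in> I" "y \<in> I" "z \<in> I"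
  shows "F (2*x*z / (x + z)) + F (2*y*z / (y + z)) + F (2*x*y / (x + y))
           \<le> h (3/2) * F (3*x*y*z / (x*y + y*z + x*z)) + h (1/2) * (F x + F y + F z)"
proof -
  define K where "K = inverse ` I"
  define g where "g u = F (inverse u)" for u
  have "convex K"
  proof -
    have "connected K"
      unfolding K_def
    proof (rule connected_continuous_image)
      show "continuous_on I inverse"
        using I(2) by (intro continuous_intros) auto
      show "connected I" using I(1) by (simp add: is_interval_connected_1)
    qed
    then show ?thesis by (simp add: is_interval_connected_1[symmetric] is_interval_convex_1)
  qed
  moreover have "g ((1 - t) * u + t * v) \<le> h (1 - t) * g u + h t * g v"
    if uv_in: "u \<in> K" "v \<in> K" and t: "0 < t" "t < 1" for u v t
  proof -
    obtain a b where ab: "a \<in> I" "b \<in> I" and uv: "u = inverse a" "v = inverse b"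
      using uv_in unfolding K_def by blast
    have "0 < a" "0 < b" using ab I(2) by auto
    then have "inverse ((1 - t) * u + t * v) = a * b / (t * a + (1 - t) * b)"
      unfolding uv by (simp add: field_simps)
    then show ?thesis using conv[OF ab t] by (simp add: g_def uv)
  qed
  moreover have "(h s + h t) * g u \<le> h (s + t) * g u"
    if "0 < s" "0 < t" "s + t \<le> 3/2" "u \<in> K" for s t u
    using that weight by (auto simp: K_def g_def)
  ultimately have "g ((inverse x + inverse z) / 2) + g ((inverse y + inverse z) / 2)
        + g ((inverse x + inverse y) / 2)
      \<le> h (3/2) * g ((inverse x + inverse y + inverse z) / 3)
        + h (1/2) * (g (inverse x) + g (inverse y) + g (inverse z))"
    using xyz by (intro popoviciu_weighted[of K]) (auto simp: K_def)
  moreover have "inverse ((inverse a + inverse b) / 2) = 2 * a * b / (a + b)"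
    if "0 < a" "0 < b" for a b :: real
    using that by (simp add: field_simps)
  moreover have "inverse ((inverse x + inverse y + inverse z) / 3)
      = 3 * x * y * z / (x*y + y*z + x*z)"
    if "0 < x" "0 < y" "0 < z"
    using that by (simp add: field_simps)
  moreover have "0 < x" "0 < y" "0 < z" using xyz I(2) by auto
  ultimately show ?thesis by (simp add: g_def)
qed

theorem theorem8:
  fixes I J :: "real set" and h f :: "real \<Rightarrow> real"
  assumes I_interval: "is_interval I" and I_pos: "I \<subseteq> {0<..}"
    and J_interval: "is_interval J" and J_unit: "{0<..<1} \<subseteq> J" and J_three_halves: "3/2 \<in> J"
    and h_nonneg: "h \<in> J \<rightarrow> {0..}"
    and h_nonzero: "\<forall>t. t \<in> J \<longrightarrow> 1 - t \<in> J \<longrightarrow> \<not> (h t = 0 \<and> h (1 - t) = 0)"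
    and f_pos: "f \<in> I \<rightarrow> {0<..}"
  shows "(superadditive_on J h \<and> HtAh_convex_on J h I f \<longrightarrow>
           (\<forall>x\<in>I. \<forall>y\<in>I. \<forall>z\<in>I.
              f (2*x*z / (x + z)) + f (2*y*z / (y + z)) + f (2*x*y / (x + y))
                \<le> h (3/2) * f (3*x*y*z / (x*y + y*z + x*z)) + h (1/2) * (f x + f y + f z)))
       \<and> (subadditive_on J h \<and> HtAh_concave_on J h I f \<longrightarrow>
           (\<forall>x\<in>I. \<forall>y\<in>I. \<forall>z\<in>I.
              f (2*x*z / (x + z)) + f (2*y*z / (y + z)) + f (2*x*y / (x + y))
                \<ge> h (3/2) * f (3*x*y*z / (x*y + y*z + x*z)) + h (1/2) * (f x + f y + f z)))"
proof -
  have J: "t \<in> J" if "0 < t" "t \<le> 3/2" for t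
  proof (cases "t < 1")
    case True
    then show ?thesis using that J_unit by auto
  next
    case False
    have "1/2 \<in> J" using J_unit by auto
    then show ?thesis
      by (rule mem_is_interval_1_I[OF J_interval _ J_three_halves]) (use False that in simp_all)
  qed
  have f: "0 \<le> f a" if "a \<in> I" for a
    using funcset_mem[OF f_pos that] by simp
  show ?thesis
  proof (intro conjI impI ballI)
    fix x y z
    assume "superadditive_on J h \<and> HtAh_convex_on J h I f" and xyz: "x \<in> I" "y \<in> I" "z \<in> I"
    then have super: "superadditive_on J h" and conv: "HtAh_convex_on J h I f" by auto
    show "f (2*x*z / (x + z)) + f (2*y*z / (y + z)) + f (2*x*y / (x + y))
        \<le> h (3/2) * f (3*x*y*z / (x*y + y*z + x*z)) + h (1/2) * (f x + f y + f z)"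
    proof (rule popoviciu_weighted_harmonic[OF I_interval I_pos _ _ xyz])
      show "f (a * b / (t * a + (1 - t) * b)) \<le> h (1 - t) * f a + h t * f b"
        if "a \<in> I" "b \<in> I" "0 < t" "t < 1" for a b t
        using conv that J[of t] J[of "1 - t"] by (simp add: HtAh_convex_on_def)
      show "(h s + h t) * f a \<le> h (s + t) * f a"
        if "0 < s" "0 < t" "s + t \<le> 3/2" "a \<in> I" for s t a
        using super that J[of s] J[of t] J[of "s + t"] f
        by (intro mult_right_mono) (auto simp: superadditive_on_def)
    qed
  next
    fix x y z
    assume "subadditive_on J h \<and> HtAh_concave_on J h I f" and xyz: "x \<in> I" "y \<in> I" "z \<in> I"
    then have sub: "subadditive_on J h" and conc: "HtAh_concave_on J h I f" by auto
    have "- f (2*x*z / (x + z)) + - f (2*y*z / (y + z)) + - f (2*x*y / (x + y))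
        \<le> h (3/2) * - f (3*x*y*z / (x*y + y*z + x*z)) + h (1/2) * (- f x + - f y + - f z)"
    proof (rule popoviciu_weighted_harmonic[OF I_interval I_pos _ _ xyz])
      show "- f (a * b / (t * a + (1 - t) * b)) \<le> h (1 - t) * - f a + h t * - f b"
        if "a \<in> I" "b \<in> I" "0 < t" "t < 1" for a b t
      proof -
        have "h (1 - t) * f a + h t * f b \<le> f (a * b / (t * a + (1 - t) * b))"
          using conc that J[of t] J[of "1 - t"] by (simp add: HtAh_concave_on_def)
        then show ?thesis by simp
      qed
      show "(h s + h t) * - f a \<le> h (s + t) * - f a"
        if "0 < s" "0 < t" "s + t \<le> 3/2" "a \<in> I" for s t a
        using sub that J[of s] J[of t] J[of "s + t"] f
        by (intro mult_right_mono_neg) (auto simp: subadditive_on_def)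
    qed
    then show "f (2*x*z / (x + z)) + f (2*y*z / (y + z)) + f (2*x*y / (x + y))
        \<ge> h (3/2) * f (3*x*y*z / (x*y + y*z + x*z)) + h (1/2) * (f x + f y + f z)"
      by (simp add: algebra_simps)
  qed
qed

end
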